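(* Let $M$ be a monoid. The process of associating to a crossed Schreier extension $A\xrightarrow{k}B\xrightarrow{\delta}C\xrightarrow{\pi}M$ its induced $M$-action on $A$ is functorial, yielding a functor $$D_1\colon\mathrm{XSExt}_M\to can\text{-}\mathcal{S}\mathrm{mod}_M$$ (sending a morphism $(\varphi,\psi)$ to the induced homomorphism $\varphi^\star$ between the kernels).
   Context: Monoids are written additively with neutral element $0$ and are not assumed commutative. $\mathbf{Mon}$ is the category of monoids (its regular epimorphisms are the surjective homomorphisms). A Schreier extension is a short exact sequence $K\xrightarrow{k}X\xrightarrow{f}M$ in $\mathbf{Mon}$ ($k$ is a kernel of $f$ and $f$ is a cokernel of $k$) such that for every $m\in M$ there is $u_m\in f^{-1}(m)$, called a representative of $m$, such that every $x\in f^{-1}(m)$ can be written as $x=k(a)+u_m$ for a unique $a\in K$. A morphism of Schreier extensions is a commutative diagram of homomorphisms between two such sequences whose middle component sends representatives to representatives. A crossed semimodule is a pair $(\delta\colon B\to C,\alpha)$ where $\delta$ is a homomorphism of monoids and $\alpha\colon C\to\mathrm{End}(B)$ is a monoid homomorphism (write $c\ast b=\alpha(c)(b)$) with $\delta(c\ast b)+c=c+\delta(b)$ and $\delta(b_1)\ast b_2+b_1=b_1+b_2$ for all $b,b_1,b_2\in B$, $c\in C$. A morphism $(\delta,\alpha)\to(\delta',\alpha')$ is a pair of homomorphisms $\varphi\colon B\to B'$, $\psi\colon C\to C'$ with $\delta'\varphi=\psi\delta$ and $\varphi(\alpha(c)(b))=\alpha'(\psi(c))(\varphi(b))$. A sequence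 $A\xrightarrow{k}B\xrightarrow{\delta}C\xrightarrow{\pi}M$ with $(\delta,\alpha)$ a crossed semimodule, $k$ a kernel and $\pi$ a cokernel of $\delta$, is a crossed Schreier extension if, for the (regular epimorphism, monomorphism) factorisation $\delta=\nu\rho$, $\rho\colon B\to N$, $\nu\colon N\to C$: ($\mathbf{CS}_r$) $N$ is right cancellative and $N\xrightarrow{\nu}C\xrightarrow{\pi}M$ is a Schreier extension; ($\mathbf{CS}_l$) $A$ is right cancellative and $A\xrightarrow{k}B\xrightarrow{\rho}N$ is a Schreier extension. It is known that then $A$ is commutative (hence cancellative), that $\alpha$ restricts to an action of $C$ on $A$, and that there is a well-defined induced action $\beta\colon M\to\mathrm{End}(A)$, $\beta(m)(a)=\alpha(c)(a)$ for any $c\in C$ with $\pi(c)=m$. $\mathrm{XSExt}_M$ is the category of crossed Schreier extensions ending in $M$; a morphism is a morphism of crossed semimodules $(\varphi,\psi)$ with $\pi'\psi=\pi$ such that, with $\varphi^\star\colon A\to A'$ and $\psi^\star\colon N\to N'$ the induced maps, $(\varphi^\star,\varphi,\psi^\star)$ and $(\psi^\star,\psi,1_M)$ are morphisms of Schreier extensions between, respectively, $A\to B\to N$ and $A'\to B'\to N'$, and $N\to C\to M$ and $N'\to C'\to M$. $can\text{-}\mathcal{S}\mathrm{mod}_M$ is the category of cancellative $M$-semimodules: pairs $(A,\beta)$ with $A$ a commutative cancellative monoid and $\beta\colon M\to\mathrm{End}(A)$ a monoid homomorphism, with action-preserving monoid homomorphisms as morphisms. *)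

theory Defs
  imports "HOL-Algebra.Group"
begin

text \<open>Monoids are written multiplicatively, as in HOL-Algebra: the additive
  \<open>x + y\<close> and \<open>0\<close> of the source become \<open>x \<otimes> y\<close> and \<open>\<one>\<close>. They are not assumed
  commutative.\<close>


section \<open>Categories and functors\<close>

text \<open>Hom-sets of distinct pairs of objects need not be disjoint, so composition
  takes the three objects as arguments: \<open>Comp \<C> X Y Z g f\<close> is \<open>g \<circ> f\<close> for
  \<open>f: X \<rightarrow> Y\<close> and \<open>g: Y \<rightarrow> Z\<close>.\<close>

record ('o, 'f) category_data =
  Ob :: "'o set"
  Hom :: "'o \<Rightarrow> 'o \<Rightarrow> 'f set"
  Ident :: "'o \<Rightarrow> 'f"
  Comp :: "'o \<Rightarrow> 'o \<Rightarrow> 'o \<Rightarrow> 'f \<Rightarrow> 'f \<Rightarrow> 'f"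

locale category =
  fixes \<C> :: "('o, 'f) category_data"
  assumes ident_closed: "X \<in> Ob \<C> \<Longrightarrow> Ident \<C> X \<in> Hom \<C> X X"
    and comp_closed: "\<lbrakk>X \<in> Ob \<C>; Y \<in> Ob \<C>; Z \<in> Ob \<C>; f \<in> Hom \<C> X Y; g \<in> Hom \<C> Y Z\<rbrakk>
      \<Longrightarrow> Comp \<C> X Y Z g f \<in> Hom \<C> X Z"
    and ident_left: "\<lbrakk>X \<in> Ob \<C>; Y \<in> Ob \<C>; f \<in> Hom \<C> X Y\<rbrakk>
      \<Longrightarrow> Comp \<C> X Y Y (Ident \<C> Y) f = f"
    and ident_right: "\<lbrakk>X \<in> Ob \<C>; Y \<in> Ob \<C>; f \<in> Hom \<C> X Y\<rbrakk>
      \<Longrightarrow> Comp \<C> X X Y f (Ident \<C> X) = f"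
    and comp_assoc: "\<lbrakk>W \<in> Ob \<C>; X \<in> Ob \<C>; Y \<in> Ob \<C>; Z \<in> Ob \<C>;
        f \<in> Hom \<C> W X; g \<in> Hom \<C> X Y; h \<in> Hom \<C> Y Z\<rbrakk>
      \<Longrightarrow> Comp \<C> W Y Z h (Comp \<C> W X Y g f) = Comp \<C> W X Z (Comp \<C> X Y Z h g) f"

locale category_functor = source: category \<C> + target: category \<D>
  for \<C> :: "('o, 'f) category_data" and \<D> :: "('p, 'g) category_data" +
  fixes obj_map :: "'o \<Rightarrow> 'p"
    and mor_map :: "'o \<Rightarrow> 'o \<Rightarrow> 'f \<Rightarrow> 'g"
  assumes obj_map_closed: "X \<in> Ob \<C> \<Longrightarrow> obj_map X \<in> Ob \<D>"
    and mor_map_closed: "\<lbrakk>X \<in> Ob \<C>; Y \<in> Ob \<C>; f \<in> Hom \<C> X Y\<rbrakk>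
      \<Longrightarrow> mor_map X Y f \<in> Hom \<D> (obj_map X) (obj_map Y)"
    and mor_map_ident: "X \<in> Ob \<C> \<Longrightarrow> mor_map X X (Ident \<C> X) = Ident \<D> (obj_map X)"
    and mor_map_comp: "\<lbrakk>X \<in> Ob \<C>; Y \<in> Ob \<C>; Z \<in> Ob \<C>; f \<in> Hom \<C> X Y; g \<in> Hom \<C> Y Z\<rbrakk>
      \<Longrightarrow> mor_map X Z (Comp \<C> X Y Z g f) =
          Comp \<D> (obj_map X) (obj_map Y) (obj_map Z) (mor_map Y Z g) (mor_map X Y f)"


section \<open>Monoids, kernels and cokernels\<close>

text \<open>Extensionality outside the carrier makes equality of homomorphisms the
  equality of functions on the carrier; preservation of \<open>\<one>\<close> is not part of
  \<open>hom\<close>.\<close>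

definition mon_hom :: "('a, 'c) monoid_scheme \<Rightarrow> ('b, 'd) monoid_scheme \<Rightarrow> ('a \<Rightarrow> 'b) set" where
  "mon_hom X Y = {f \<in> hom X Y. f \<one>\<^bsub>X\<^esub> = \<one>\<^bsub>Y\<^esub> \<and> f \<in> extensional (carrier X)}"

definition mon_id :: "('a, 'c) monoid_scheme \<Rightarrow> 'a \<Rightarrow> 'a" where
  "mon_id X = (\<lambda>x\<in>carrier X. x)"

definition mon_zero :: "('a, 'c) monoid_scheme \<Rightarrow> ('b, 'd) monoid_scheme \<Rightarrow> 'a \<Rightarrow> 'b" where
  "mon_zero X Y = (\<lambda>x\<in>carrier X. \<one>\<^bsub>Y\<^esub>)"

definition End_monoid :: "('a, 'c) monoid_scheme \<Rightarrow> ('a \<Rightarrow> 'a) monoid" where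
  "End_monoid X = \<lparr>carrier = mon_hom X X, mult = compose (carrier X), one = mon_id X\<rparr>"

definition right_cancellative :: "('a, 'c) monoid_scheme \<Rightarrow> bool" where
  "right_cancellative X \<longleftrightarrow> (\<forall>x\<in>carrier X. \<forall>y\<in>carrier X. \<forall>z\<in>carrier X.
     x \<otimes>\<^bsub>X\<^esub> z = y \<otimes>\<^bsub>X\<^esub> z \<longrightarrow> x = y)"

definition left_cancellative :: "('a, 'c) monoid_scheme \<Rightarrow> bool" where
  "left_cancellative X \<longleftrightarrow> (\<forall>x\<in>carrier X. \<forall>y\<in>carrier X. \<forall>z\<in>carrier X.
     z \<otimes>\<^bsub>X\<^esub> x = z \<otimes>\<^bsub>X\<^esub> y \<longrightarrow> x = y)"

text \<open>The type \<open>'u\<close> serves as a universe: \<open>Mon\<close> is the category of all monoids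
  whose carrier is a subset of \<open>'u\<close>, and kernels and cokernels are taken in it by their
  universal property. Test monoids carried by \<open>'u\<close> suffice: lemmas \<open>kernel_universal\<close> and
  \<open>cokernel_universal\<close> show that the universal property then holds against monoids over every type.\<close>

definition is_kernel ::
  "'u monoid \<Rightarrow> ('u \<Rightarrow> 'u) \<Rightarrow> 'u monoid \<Rightarrow> ('u \<Rightarrow> 'u) \<Rightarrow> 'u monoid \<Rightarrow> bool" where
  "is_kernel K k X f Y \<longleftrightarrow>
     monoid K \<and> monoid X \<and> monoid Y \<and> k \<in> mon_hom K X \<and> f \<in> mon_hom X Y \<and>
     compose (carrier K) f k = mon_zero K Y \<and>
     (\<forall>(Z :: 'u monoid) g. monoid Z \<longrightarrow> g \<in> mon_hom Z X \<longrightarrow>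
        compose (carrier Z) f g = mon_zero Z Y \<longrightarrow>
        (\<exists>!h. h \<in> mon_hom Z K \<and> compose (carrier Z) k h = g))"

definition is_cokernel ::
  "'u monoid \<Rightarrow> ('u \<Rightarrow> 'u) \<Rightarrow> 'u monoid \<Rightarrow> ('u \<Rightarrow> 'u) \<Rightarrow> 'u monoid \<Rightarrow> bool" where
  "is_cokernel K k X f Y \<longleftrightarrow>
     monoid K \<and> monoid X \<and> monoid Y \<and> k \<in> mon_hom K X \<and> f \<in> mon_hom X Y \<and>
     compose (carrier K) f k = mon_zero K Y \<and>
     (\<forall>(Z :: 'u monoid) g. monoid Z \<longrightarrow> g \<in> mon_hom X Z \<longrightarrow>
        compose (carrier K) g k = mon_zero K Z \<longrightarrow>
        (\<exists>!h. h \<in> mon_hom Y Z \<and> compose (carrier X) h f = g))"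

lemma mon_homD:
  assumes "f \<in> mon_hom X Y"
  shows "\<And>x. x \<in> carrier X \<Longrightarrow> f x \<in> carrier Y"
    and "\<And>x y. x \<in> carrier X \<Longrightarrow> y \<in> carrier X \<Longrightarrow> f (x \<otimes>\<^bsub>X\<^esub> y) = f x \<otimes>\<^bsub>Y\<^esub> f y"
    and "f \<one>\<^bsub>X\<^esub> = \<one>\<^bsub>Y\<^esub>"
    and "f \<in> extensional (carrier X)"
  using assms by (auto simp: mon_hom_def hom_def)

lemma mon_homI:
  assumes "\<And>x. x \<in> carrier X \<Longrightarrow> f x \<in> carrier Y"
    and "\<And>x y. x \<in> carrier X \<Longrightarrow> y \<in> carrier X \<Longrightarrow> f (x \<otimes>\<^bsub>X\<^esub> y) = f x \<otimes>\<^bsub>Y\<^esub> f y"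
    and "f \<one>\<^bsub>X\<^esub> = \<one>\<^bsub>Y\<^esub>"
    and "f \<in> extensional (carrier X)"
  shows "f \<in> mon_hom X Y"
  using assms by (auto simp: mon_hom_def hom_def)

lemma compose_eqD: "compose A g f = h \<Longrightarrow> x \<in> A \<Longrightarrow> g (f x) = h x"
  by (auto simp: compose_def)

lemma compose_eqI:
  assumes "\<And>x. x \<in> A \<Longrightarrow> g (f x) = h x" "h \<in> extensional A"
  shows "compose A g f = h"
  using assms by (auto simp: compose_def extensional_def restrict_def fun_eq_iff)

lemma mon_homs_eqI:
  assumes "f \<in> mon_hom X Y" "g \<in> mon_hom X Z" "\<And>x. x \<in> carrier X \<Longrightarrow> f x = g x"
  shows "f = g"
  using assms by (metis extensionalityI mon_homD(4))

lemma mon_hom_comp: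
  assumes "monoid X" "f \<in> mon_hom X Y" "g \<in> mon_hom Y Z"
  shows "compose (carrier X) g f \<in> mon_hom X Z"
proof -
  interpret X: monoid X by fact
  show ?thesis
    using mon_homD[OF assms(2)] mon_homD[OF assms(3)]
    by (intro mon_homI) (auto simp: compose_def)
qed

lemma mon_id_hom: "monoid X \<Longrightarrow> mon_id X \<in> mon_hom X X"
  by (auto intro!: mon_homI simp: mon_id_def monoid.m_closed monoid.one_closed)

lemma submonoid_incl:
  assumes "monoid X" "S \<subseteq> carrier X" "\<one>\<^bsub>X\<^esub> \<in> S" "\<And>x y. x \<in> S \<Longrightarrow> y \<in> S \<Longrightarrow> x \<otimes>\<^bsub>X\<^esub> y \<in> S"
  shows "monoid (X\<lparr>carrier := S\<rparr>)" "(\<lambda>x\<in>S. x) \<in> mon_hom (X\<lparr>carrier := S\<rparr>) X"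
proof -
  interpret X: monoid X by fact
  show "monoid (X\<lparr>carrier := S\<rparr>)"
    using assms(2-) by unfold_locales (auto simp: X.m_assoc subset_iff)
  show "(\<lambda>x\<in>S. x) \<in> mon_hom (X\<lparr>carrier := S\<rparr>) X"
    using assms(2-) by (auto intro!: mon_homI)
qed

lemma kernel_inj_image:
  fixes K X Y :: "'u monoid"
  assumes ker: "is_kernel K k X f Y"
  shows "inj_on k (carrier K)" "k ` carrier K = {x \<in> carrier X. f x = \<one>\<^bsub>Y\<^esub>}"
proof -
  have mon: "monoid K" "monoid X" "monoid Y" and k: "k \<in> mon_hom K X" and f: "f \<in> mon_hom X Y"
    and fk: "compose (carrier K) f k = mon_zero K Y"
    and univ: "\<And>(Z :: 'u monoid) g. monoid Z \<Longrightarrow> g \<in> mon_hom Z X \<Longrightarrow>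
        compose (carrier Z) f g = mon_zero Z Y \<Longrightarrow>
        \<exists>!h. h \<in> mon_hom Z K \<and> compose (carrier Z) k h = g"
    using ker unfolding is_kernel_def by blast+
  interpret K: monoid K by fact
  interpret X: monoid X by fact
  interpret Y: monoid Y by fact
  define S where "S = {x \<in> carrier X. f x = \<one>\<^bsub>Y\<^esub>}"
  have S: "S \<subseteq> carrier X" "\<one>\<^bsub>X\<^esub> \<in> S" "\<And>x y. x \<in> S \<Longrightarrow> y \<in> S \<Longrightarrow> x \<otimes>\<^bsub>X\<^esub> y \<in> S"
    using mon_homD[OF f] by (auto simp: S_def)
  note sub = submonoid_incl[OF mon(2) S]
  have "compose (carrier (X\<lparr>carrier := S\<rparr>)) f (\<lambda>x\<in>S. x) = mon_zero (X\<lparr>carrier := S\<rparr>) Y"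
    by (intro compose_eqI) (auto simp: mon_zero_def S_def)
  then obtain s where s: "s \<in> mon_hom (X\<lparr>carrier := S\<rparr>) K"
    and ks: "compose (carrier (X\<lparr>carrier := S\<rparr>)) k s = (\<lambda>x\<in>S. x)"
    using univ[OF sub] by blast
  have ks': "k (s x) = x" if "x \<in> S" for x
    using compose_eqD[OF ks, of x] that by simp
  have sK: "s x \<in> carrier K" if "x \<in> S" for x
    using mon_homD(1)[OF s] that by simp
  have kS: "k a \<in> S" if "a \<in> carrier K" for a
    using compose_eqD[OF fk that] mon_homD(1)[OF k that] that by (simp add: S_def mon_zero_def)
  show "k ` carrier K = {x \<in> carrier X. f x = \<one>\<^bsub>Y\<^esub>}"
    using ks' sK kS unfolding S_def[symmetric] by (auto simp: image_iff) metis
  have kS_hom: "k \<in> mon_hom K (X\<lparr>carrier := S\<rparr>)"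
    using mon_homD[OF k] kS by (intro mon_homI) auto
  have sk: "compose (carrier K) s k \<in> mon_hom K K"
    by (rule mon_hom_comp[OF mon(1) kS_hom s])
  have "compose (carrier K) k (compose (carrier K) s k) = k"
    using mon_homD(4)[OF k] kS ks' by (intro compose_eqI) (auto simp: compose_def)
  moreover have "compose (carrier K) k (mon_id K) = k"
    using mon_homD(4)[OF k] by (intro compose_eqI) (auto simp: mon_id_def)
  ultimately have "compose (carrier K) s k = mon_id K"
    using univ[OF mon(1) k fk] sk mon_id_hom[OF mon(1)] by blast
  then have "s (k a) = a" if "a \<in> carrier K" for a
    using that compose_eqD[of "carrier K" s k] by (simp add: mon_id_def)
  then show "inj_on k (carrier K)"
    by (metis inj_onI)
qed

lemma kernel_universal:
  fixes K X Y :: "'u monoid" and Z :: "'z monoid"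
  assumes ker: "is_kernel K k X f Y" and Z: "monoid Z" and g: "g \<in> mon_hom Z X"
    and fg: "compose (carrier Z) f g = mon_zero Z Y"
  shows "\<exists>!h. h \<in> mon_hom Z K \<and> compose (carrier Z) k h = g"
proof -
  have mon: "monoid K" "monoid X" and k: "k \<in> mon_hom K X"
    using ker unfolding is_kernel_def by blast+
  interpret K: monoid K by fact
  interpret X: monoid X by fact
  interpret Z: monoid Z by fact
  note inj = kernel_inj_image(1)[OF ker] and img = kernel_inj_image(2)[OF ker]
  define h where "h = (\<lambda>z\<in>carrier Z. inv_into (carrier K) k (g z))"
  have "g z \<in> k ` carrier K" if "z \<in> carrier Z" for z
    using compose_eqD[OF fg that] mon_homD(1)[OF g that] that unfolding img
    by (simp add: mon_zero_def)
  then have hK: "h z \<in> carrier K" and kh: "k (h z) = g z" if "z \<in> carrier Z" for z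
    using that by (auto simp: h_def inv_into_into f_inv_into_f)
  have "h \<in> mon_hom Z K"
  proof (rule mon_homI)
    fix x y assume "x \<in> carrier Z" "y \<in> carrier Z"
    then show "h (x \<otimes>\<^bsub>Z\<^esub> y) = h x \<otimes>\<^bsub>K\<^esub> h y"
      using hK kh mon_homD(2)[OF g] mon_homD(2)[OF k] by (rule_tac inj_onD[OF inj]) auto
  next
    show "h \<one>\<^bsub>Z\<^esub> = \<one>\<^bsub>K\<^esub>"
      using hK kh mon_homD(3)[OF g] mon_homD(3)[OF k] by (rule_tac inj_onD[OF inj]) auto
  qed (use hK in \<open>auto simp: h_def\<close>)
  moreover have "compose (carrier Z) k h = g"
    using kh mon_homD(4)[OF g] by (intro compose_eqI) auto
  moreover have "h' = h" if "h' \<in> mon_hom Z K" "compose (carrier Z) k h' = g" for h'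
  proof (rule mon_homs_eqI[OF that(1) \<open>h \<in> mon_hom Z K\<close>])
    fix z assume "z \<in> carrier Z"
    then show "h' z = h z"
      using compose_eqD[OF that(2)] kh hK mon_homD(1)[OF that(1)] by (rule_tac inj_onD[OF inj]) auto
  qed
  ultimately show ?thesis by blast
qed

lemma cokernel_surj:
  fixes K X Y :: "'u monoid"
  assumes coker: "is_cokernel K k X f Y"
  shows "f ` carrier X = carrier Y"
proof -
  have mon: "monoid K" "monoid X" "monoid Y" and k: "k \<in> mon_hom K X" and f: "f \<in> mon_hom X Y"
    and fk: "compose (carrier K) f k = mon_zero K Y"
    and univ: "\<And>(Z :: 'u monoid) g. monoid Z \<Longrightarrow> g \<in> mon_hom X Z \<Longrightarrow>
        compose (carrier K) g k = mon_zero K Z \<Longrightarrow>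
        \<exists>!h. h \<in> mon_hom Y Z \<and> compose (carrier X) h f = g"
    using coker unfolding is_cokernel_def by blast+
  interpret X: monoid X by fact
  interpret Y: monoid Y by fact
  define S where "S = f ` carrier X"
  have S: "S \<subseteq> carrier Y" "\<one>\<^bsub>Y\<^esub> \<in> S" "\<And>x y. x \<in> S \<Longrightarrow> y \<in> S \<Longrightarrow> x \<otimes>\<^bsub>Y\<^esub> y \<in> S"
  proof -
    show "S \<subseteq> carrier Y" using mon_homD(1)[OF f] by (auto simp: S_def)
    show "\<one>\<^bsub>Y\<^esub> \<in> S" using mon_homD(3)[OF f] X.one_closed by (force simp: S_def)
    show "x \<otimes>\<^bsub>Y\<^esub> y \<in> S" if "x \<in> S" "y \<in> S" for x y
      using that by (auto simp: S_def mon_homD(2)[OF f, symmetric])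
  qed
  note sub = submonoid_incl[OF mon(3) S]
  have fS: "f \<in> mon_hom X (Y\<lparr>carrier := S\<rparr>)"
    using mon_homD[OF f] by (intro mon_homI) (auto simp: S_def)
  have "compose (carrier K) f k = mon_zero K (Y\<lparr>carrier := S\<rparr>)"
    using fk by (simp add: mon_zero_def)
  then obtain h where h: "h \<in> mon_hom Y (Y\<lparr>carrier := S\<rparr>)" and hf: "compose (carrier X) h f = f"
    using univ[OF sub(1) fS] by blast
  have hY: "h \<in> mon_hom Y Y"
    using mon_homD[OF h] S(1) by (intro mon_homI) auto
  have "compose (carrier X) (mon_id Y) f = f"
    using mon_homD[OF f] by (intro compose_eqI) (auto simp: mon_id_def)
  then have "h = mon_id Y"
    using univ[OF mon(3) f fk] hY hf mon_id_hom[OF mon(3)] by blast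
  then have "y \<in> S" if "y \<in> carrier Y" for y
    using mon_homD(1)[OF h that] that by (simp add: mon_id_def)
  then show ?thesis using S(1) unfolding S_def by blast
qed

lemma cokernel_universal:
  fixes K X Y :: "'u monoid" and Z :: "'z monoid"
  assumes coker: "is_cokernel K k X f Y" and Z: "monoid Z" and g: "g \<in> mon_hom X Z"
    and gk: "compose (carrier K) g k = mon_zero K Z"
  shows "\<exists>!h. h \<in> mon_hom Y Z \<and> compose (carrier X) h f = g"
proof -
  have mon: "monoid K" "monoid X" "monoid Y" and k: "k \<in> mon_hom K X" and f: "f \<in> mon_hom X Y"
    and univ: "\<And>(Z :: 'u monoid) g. monoid Z \<Longrightarrow> g \<in> mon_hom X Z \<Longrightarrow>
        compose (carrier K) g k = mon_zero K Z \<Longrightarrow>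
        \<exists>!h. h \<in> mon_hom Y Z \<and> compose (carrier X) h f = g"
    using coker unfolding is_cokernel_def by blast+
  interpret X: monoid X by fact
  interpret Y: monoid Y by fact
  interpret Z: monoid Z by fact
  note surj = cokernel_surj[OF coker]
  \<comment> \<open>The image of \<open>g\<close> is transported to \<open>'u\<close> along chosen preimages.\<close>
  define r where "r = (\<lambda>x\<in>carrier X. inv_into (carrier X) g (g x))"
  have rX: "r x \<in> carrier X" and gr: "g (r x) = g x" if "x \<in> carrier X" for x
    using that by (auto simp: r_def inv_into_into f_inv_into_f)
  have r_eq: "r x = r y" if "x \<in> carrier X" "y \<in> carrier X" "g x = g y" for x y
    using that by (simp add: r_def)
  have rr: "r (r x \<otimes>\<^bsub>X\<^esub> r y) = r (x \<otimes>\<^bsub>X\<^esub> y)" if "x \<in> carrier X" "y \<in> carrier X" for x y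
    using that rX gr mon_homD(2)[OF g] by (intro r_eq) auto
  define I :: "'u monoid" where
    "I = \<lparr>carrier = r ` carrier X, mult = (\<lambda>x y. r (x \<otimes>\<^bsub>X\<^esub> y)), one = r \<one>\<^bsub>X\<^esub>\<rparr>"
  have rI: "r \<in> mon_hom X I"
    using rr by (intro mon_homI) (auto simp: I_def r_def)
  have "r (r (r x \<otimes>\<^bsub>X\<^esub> r y) \<otimes>\<^bsub>X\<^esub> r z) = r (r x \<otimes>\<^bsub>X\<^esub> r (r y \<otimes>\<^bsub>X\<^esub> r z))"
    if "x \<in> carrier X" "y \<in> carrier X" "z \<in> carrier X" for x y z
    using that rr[of "x \<otimes>\<^bsub>X\<^esub> y" z] rr[of x "y \<otimes>\<^bsub>X\<^esub> z"] by (simp add: rr X.m_assoc)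
  moreover have "r (r \<one>\<^bsub>X\<^esub> \<otimes>\<^bsub>X\<^esub> r x) = r x" "r (r x \<otimes>\<^bsub>X\<^esub> r \<one>\<^bsub>X\<^esub>) = r x" if "x \<in> carrier X" for x
    using that by (simp_all add: rr)
  ultimately have I: "monoid I"
    using rX by unfold_locales (auto simp: I_def)
  have "compose (carrier K) r k = mon_zero K I"
  proof (rule compose_eqI)
    fix a assume a: "a \<in> carrier K"
    then have "g (k a) = g \<one>\<^bsub>X\<^esub>"
      using compose_eqD[OF gk a] mon_homD(3)[OF g] by (simp add: mon_zero_def)
    then show "r (k a) = mon_zero K I a"
      using a r_eq[of "k a" "\<one>\<^bsub>X\<^esub>"] mon_homD(1)[OF k a] by (simp add: mon_zero_def I_def)
  qed (simp add: mon_zero_def)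
  then obtain h0 where h0: "h0 \<in> mon_hom Y I" and h0f: "compose (carrier X) h0 f = r"
    using univ[OF I rI] by blast
  have gI: "restrict g (carrier I) \<in> mon_hom I Z"
  proof (rule mon_homI)
    fix u v assume uv: "u \<in> carrier I" "v \<in> carrier I"
    then have X: "u \<in> carrier X" "v \<in> carrier X"
      using rX by (auto simp: I_def)
    then have "u \<otimes>\<^bsub>I\<^esub> v \<in> carrier I" "g (u \<otimes>\<^bsub>I\<^esub> v) = g u \<otimes>\<^bsub>Z\<^esub> g v"
      using mon_homD(2)[OF g] gr by (auto simp: I_def)
    then show "restrict g (carrier I) (u \<otimes>\<^bsub>I\<^esub> v) =
        restrict g (carrier I) u \<otimes>\<^bsub>Z\<^esub> restrict g (carrier I) v"
      using uv by simp
  next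
    have "\<one>\<^bsub>I\<^esub> \<in> carrier I" "g \<one>\<^bsub>I\<^esub> = \<one>\<^bsub>Z\<^esub>"
      using mon_homD(3)[OF g] gr[of "\<one>\<^bsub>X\<^esub>"] by (auto simp: I_def)
    then show "restrict g (carrier I) \<one>\<^bsub>I\<^esub> = \<one>\<^bsub>Z\<^esub>"
      by simp
  qed (use rX mon_homD(1)[OF g] in \<open>auto simp: I_def\<close>)
  define h where "h = compose (carrier Y) (restrict g (carrier I)) h0"
  have h: "h \<in> mon_hom Y Z"
    unfolding h_def by (rule mon_hom_comp[OF mon(3) h0 gI])
  have "compose (carrier X) h f = g"
  proof (rule compose_eqI)
    fix x assume x: "x \<in> carrier X"
    then show "h (f x) = g x"
      using compose_eqD[OF h0f x] mon_homD(1)[OF f x] mon_homD(1)[OF rI x] gr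
      by (simp add: h_def compose_def)
  qed (rule mon_homD(4)[OF g])
  moreover have "h' = h" if h': "h' \<in> mon_hom Y Z" "compose (carrier X) h' f = g" for h'
  proof (rule mon_homs_eqI[OF h'(1) h])
    fix y assume "y \<in> carrier Y"
    then obtain x where "x \<in> carrier X" "y = f x" using surj by blast
    then show "h' y = h y"
      using compose_eqD[OF h'(2)] compose_eqD[OF \<open>compose (carrier X) h f = g\<close>] by simp
  qed
  ultimately show ?thesis using h by blast
qed

section \<open>Schreier extensions\<close>

text \<open>The sequence \<open>lft \<rightarrow> mid \<rightarrow> rgt\<close> with maps \<open>inc\<close> and \<open>prj\<close>.\<close>

record 'u short_seq =
  lft :: "'u monoid"
  mid :: "'u monoid"
  rgt :: "'u monoid"
  inc :: "'u \<Rightarrow> 'u"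
  prj :: "'u \<Rightarrow> 'u"

definition representative :: "'u short_seq \<Rightarrow> 'u \<Rightarrow> 'u \<Rightarrow> bool" where
  "representative S m u \<longleftrightarrow> u \<in> carrier (mid S) \<and> prj S u = m \<and>
     (\<forall>x\<in>carrier (mid S). prj S x = m \<longrightarrow>
        (\<exists>!a. a \<in> carrier (lft S) \<and> x = inc S a \<otimes>\<^bsub>mid S\<^esub> u))"

definition schreier_extension :: "'u short_seq \<Rightarrow> bool" where
  "schreier_extension S \<longleftrightarrow>
     is_kernel (lft S) (inc S) (mid S) (prj S) (rgt S) \<and>
     is_cokernel (lft S) (inc S) (mid S) (prj S) (rgt S) \<and>
     (\<forall>m\<in>carrier (rgt S). \<exists>u. representative S m u)"

definition schreier_morphism ::
  "'u short_seq \<Rightarrow> 'u short_seq \<Rightarrow> ('u \<Rightarrow> 'u) \<Rightarrow> ('u \<Rightarrow> 'u) \<Rightarrow> ('u \<Rightarrow> 'u) \<Rightarrow> bool" where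
  "schreier_morphism S S' p q r \<longleftrightarrow>
     p \<in> mon_hom (lft S) (lft S') \<and> q \<in> mon_hom (mid S) (mid S') \<and> r \<in> mon_hom (rgt S) (rgt S') \<and>
     compose (carrier (lft S)) q (inc S) = compose (carrier (lft S)) (inc S') p \<and>
     compose (carrier (mid S)) r (prj S) = compose (carrier (mid S)) (prj S') q \<and>
     (\<forall>m u. representative S m u \<longrightarrow> representative S' (r m) (q u))"


section \<open>Crossed semimodules and crossed Schreier extensions\<close>

definition crossed_semimodule ::
  "'u monoid \<Rightarrow> 'u monoid \<Rightarrow> ('u \<Rightarrow> 'u) \<Rightarrow> ('u \<Rightarrow> 'u \<Rightarrow> 'u) \<Rightarrow> bool" where
  "crossed_semimodule B C \<delta> \<alpha> \<longleftrightarrow>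
     monoid B \<and> monoid C \<and> \<delta> \<in> mon_hom B C \<and> \<alpha> \<in> mon_hom C (End_monoid B) \<and>
     (\<forall>b\<in>carrier B. \<forall>c\<in>carrier C. \<delta> (\<alpha> c b) \<otimes>\<^bsub>C\<^esub> c = c \<otimes>\<^bsub>C\<^esub> \<delta> b) \<and>
     (\<forall>b\<^sub>1\<in>carrier B. \<forall>b\<^sub>2\<in>carrier B. \<alpha> (\<delta> b\<^sub>1) b\<^sub>2 \<otimes>\<^bsub>B\<^esub> b\<^sub>1 = b\<^sub>1 \<otimes>\<^bsub>B\<^esub> b\<^sub>2)"

text \<open>The data of a sequence \<open>A \<rightarrow> B \<rightarrow> C \<rightarrow> M\<close> with maps \<open>\<kappa>\<close>, \<open>\<delta>\<close>, \<open>\<pi>\<close> and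
  with \<open>C\<close> acting on \<open>B\<close> by \<open>\<alpha>\<close>; the end \<open>M\<close> is kept as a separate parameter.\<close>

record 'u crossed_seq =
  seqA :: "'u monoid"
  seqB :: "'u monoid"
  seqC :: "'u monoid"
  map\<kappa> :: "'u \<Rightarrow> 'u"
  map\<delta> :: "'u \<Rightarrow> 'u"
  map\<pi> :: "'u \<Rightarrow> 'u"
  act\<alpha> :: "'u \<Rightarrow> 'u \<Rightarrow> 'u"

text \<open>The (regular epimorphism, monomorphism) factorisation \<open>\<delta> = \<nu> \<rho>\<close> is the one through
  the image \<open>N = \<delta>(B)\<close>. As functions carry no codomain, the corestriction
  \<open>\<rho>: B \<rightarrow> N\<close> is \<open>map\<delta> E\<close> itself.\<close>

definition seqN :: "'u crossed_seq \<Rightarrow> 'u monoid" where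
  "seqN E = (seqC E)\<lparr>carrier := map\<delta> E ` carrier (seqB E)\<rparr>"

definition map\<nu> :: "'u crossed_seq \<Rightarrow> 'u \<Rightarrow> 'u" where
  "map\<nu> E = (\<lambda>n\<in>carrier (seqN E). n)"

definition left_seq :: "'u crossed_seq \<Rightarrow> 'u short_seq" where
  "left_seq E = \<lparr>lft = seqA E, mid = seqB E, rgt = seqN E, inc = map\<kappa> E, prj = map\<delta> E\<rparr>"

definition right_seq :: "'u monoid \<Rightarrow> 'u crossed_seq \<Rightarrow> 'u short_seq" where
  "right_seq M E = \<lparr>lft = seqN E, mid = seqC E, rgt = M, inc = map\<nu> E, prj = map\<pi> E\<rparr>"

definition crossed_schreier_extension :: "'u monoid \<Rightarrow> 'u crossed_seq \<Rightarrow> bool" where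
  "crossed_schreier_extension M E \<longleftrightarrow>
     crossed_semimodule (seqB E) (seqC E) (map\<delta> E) (act\<alpha> E) \<and>
     is_kernel (seqA E) (map\<kappa> E) (seqB E) (map\<delta> E) (seqC E) \<and>
     is_cokernel (seqB E) (map\<delta> E) (seqC E) (map\<pi> E) M \<and>
     right_cancellative (seqN E) \<and> schreier_extension (right_seq M E) \<and>
     right_cancellative (seqA E) \<and> schreier_extension (left_seq E)"

definition crossed_semimodule_morphism ::
  "'u crossed_seq \<Rightarrow> 'u crossed_seq \<Rightarrow> ('u \<Rightarrow> 'u) \<Rightarrow> ('u \<Rightarrow> 'u) \<Rightarrow> bool" where
  "crossed_semimodule_morphism E E' \<phi> \<psi> \<longleftrightarrow>
     \<phi> \<in> mon_hom (seqB E) (seqB E') \<and> \<psi> \<in> mon_hom (seqC E) (seqC E') \<and>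
     compose (carrier (seqB E)) (map\<delta> E') \<phi> = compose (carrier (seqB E)) \<psi> (map\<delta> E) \<and>
     (\<forall>c\<in>carrier (seqC E). \<forall>b\<in>carrier (seqB E). \<phi> (act\<alpha> E c b) = act\<alpha> E' (\<psi> c) (\<phi> b))"

definition induced_A :: "'u crossed_seq \<Rightarrow> 'u crossed_seq \<Rightarrow> ('u \<Rightarrow> 'u) \<Rightarrow> 'u \<Rightarrow> 'u" where
  "induced_A E E' \<phi> = (THE h. h \<in> mon_hom (seqA E) (seqA E') \<and>
     compose (carrier (seqA E)) (map\<kappa> E') h = compose (carrier (seqA E)) \<phi> (map\<kappa> E))"

definition induced_N :: "'u crossed_seq \<Rightarrow> 'u crossed_seq \<Rightarrow> ('u \<Rightarrow> 'u) \<Rightarrow> 'u \<Rightarrow> 'u" where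
  "induced_N E E' \<psi> = (THE h. h \<in> mon_hom (seqN E) (seqN E') \<and>
     compose (carrier (seqN E)) (map\<nu> E') h = compose (carrier (seqN E)) \<psi> (map\<nu> E))"

definition XSExt_hom ::
  "'u monoid \<Rightarrow> 'u crossed_seq \<Rightarrow> 'u crossed_seq \<Rightarrow> (('u \<Rightarrow> 'u) \<times> ('u \<Rightarrow> 'u)) set" where
  "XSExt_hom M E E' = {(\<phi>, \<psi>).
     crossed_semimodule_morphism E E' \<phi> \<psi> \<and>
     compose (carrier (seqC E)) (map\<pi> E') \<psi> = map\<pi> E \<and>
     schreier_morphism (left_seq E) (left_seq E') (induced_A E E' \<phi>) \<phi> (induced_N E E' \<psi>) \<and>
     schreier_morphism (right_seq M E) (right_seq M E') (induced_N E E' \<psi>) \<psi> (mon_id M)}"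

definition XSExt ::
  "'u monoid \<Rightarrow> ('u crossed_seq, ('u \<Rightarrow> 'u) \<times> ('u \<Rightarrow> 'u)) category_data" where
  "XSExt M = \<lparr>Ob = {E. crossed_schreier_extension M E},
     Hom = XSExt_hom M,
     Ident = (\<lambda>E. (mon_id (seqB E), mon_id (seqC E))),
     Comp = (\<lambda>E E' E'' (\<phi>', \<psi>') (\<phi>, \<psi>).
       (compose (carrier (seqB E)) \<phi>' \<phi>, compose (carrier (seqC E)) \<psi>' \<psi>))\<rparr>"


section \<open>Cancellative semimodules and the functor\<close>

type_synonym 'u semimodule_data = "'u monoid \<times> ('u \<Rightarrow> 'u \<Rightarrow> 'u)"

definition canSmod :: "'u monoid \<Rightarrow> ('u semimodule_data, 'u \<Rightarrow> 'u) category_data" where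
  "canSmod M = \<lparr>Ob = {(A, \<beta>). comm_monoid A \<and> left_cancellative A \<and> right_cancellative A \<and>
                     \<beta> \<in> mon_hom M (End_monoid A)},
     Hom = (\<lambda>(A, \<beta>) (A', \<beta>'). {f \<in> mon_hom A A'.
              \<forall>m\<in>carrier M. \<forall>a\<in>carrier A. f (\<beta> m a) = \<beta>' m (f a)}),
     Ident = (\<lambda>(A, \<beta>). mon_id A),
     Comp = (\<lambda>(A, \<beta>) _ _ g f. compose (carrier A) g f)\<rparr>"

text \<open>\<open>A\<close> is identified with its image in \<open>B\<close> under \<open>\<kappa>\<close>, so \<open>\<beta>(m)(a) = \<alpha>(c)(a)\<close> reads
  \<open>\<kappa>(\<beta>(m)(a)) = \<alpha>(c)(\<kappa>(a))\<close>.\<close>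

definition induced_action :: "'u monoid \<Rightarrow> 'u crossed_seq \<Rightarrow> 'u \<Rightarrow> 'u \<Rightarrow> 'u" where
  "induced_action M E = (\<lambda>m\<in>carrier M. \<lambda>a\<in>carrier (seqA E).
     THE a'. a' \<in> carrier (seqA E) \<and>
       (\<forall>c\<in>carrier (seqC E). map\<pi> E c = m \<longrightarrow> map\<kappa> E a' = act\<alpha> E c (map\<kappa> E a)))"

definition D1_obj :: "'u monoid \<Rightarrow> 'u crossed_seq \<Rightarrow> 'u semimodule_data" where
  "D1_obj M E = (seqA E, induced_action M E)"

definition D1_mor ::
  "'u crossed_seq \<Rightarrow> 'u crossed_seq \<Rightarrow> ('u \<Rightarrow> 'u) \<times> ('u \<Rightarrow> 'u) \<Rightarrow> 'u \<Rightarrow> 'u" where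
  "D1_mor E E' = (\<lambda>(\<phi>, \<psi>). induced_A E E' \<phi>)"

end

theory Submission
  imports Defs
begin

text \<open>The Peiffer identity with \<open>\<delta>(\<kappa> a) = 1\<close> makes \<open>\<kappa>(A)\<close> central in \<open>B\<close>. The other identity
  gives \<open>\<delta>(c \<cdot> \<kappa> a) c = c\<close>; writing \<open>c = n u\<close> with \<open>u\<close> a representative, uniqueness in the
  Schreier condition and cancellation in \<open>N\<close> yield \<open>\<delta>(c \<cdot> \<kappa> a) = 1\<close>, so that \<open>C\<close> acts on
  \<open>A\<close>. The same argument in \<open>A \<rightarrow> B \<rightarrow> N\<close> shows that \<open>N\<close> acts trivially on \<open>A\<close>, and
  the action descends to \<open>M\<close>. Functoriality follows from the injectivity of \<open>\<kappa>\<close> and the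
  surjectivity of \<open>\<pi>\<close>.\<close>

section \<open>Schreier extensions\<close>

lemma mon_id_apply [simp]: "x \<in> carrier X \<Longrightarrow> mon_id X x = x"
  by (simp add: mon_id_def)

lemma compose_mon_id_left: "f \<in> mon_hom X Y \<Longrightarrow> compose (carrier X) (mon_id Y) f = f"
  by (rule compose_eqI) (simp_all add: mon_homD(1,4))

lemma compose_mon_id_right: "f \<in> mon_hom X Y \<Longrightarrow> compose (carrier X) f (mon_id X) = f"
  by (rule compose_eqI) (simp_all add: mon_homD(4))

lemma compose_mon_hom_assoc:
  assumes "f \<in> mon_hom W X"
  shows "compose (carrier W) h (compose (carrier W) g f) = compose (carrier W) (compose (carrier X) h g) f"
  using mon_homD(1)[OF assms] by (intro compose_eqI) (auto simp: compose_def)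

section \<open>Cancellation against the middle term of a Schreier extension\<close>

lemma schreier_extensionD:
  assumes "schreier_extension S"
  shows "monoid (lft S)" "monoid (mid S)" "monoid (rgt S)"
    and "inc S \<in> mon_hom (lft S) (mid S)" "prj S \<in> mon_hom (mid S) (rgt S)"
  using assms unfolding schreier_extension_def is_kernel_def by blast+

text \<open>The Schreier condition gives uniqueness of coefficients only in front of a
  representative. If \<open>lft S\<close> is right cancellative, this extends to every
  \<open>x\<close>: write \<open>x\<close> as \<open>inc S a\<close> times a representative
  \<open>u\<close>, compare the coefficients \<open>y a\<close> and \<open>y' a\<close> in front of
  \<open>u\<close>, then cancel \<open>a\<close>. This replaces cancellation in
  \<open>mid S\<close>, which is not assumed.\<close>

lemma schreier_right_cancel:
  assumes S: "schreier_extension S" and canc: "right_cancellative (lft S)"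
    and y: "y \<in> carrier (lft S)" "y' \<in> carrier (lft S)" and x: "x \<in> carrier (mid S)"
    and eq: "inc S y \<otimes>\<^bsub>mid S\<^esub> x = inc S y' \<otimes>\<^bsub>mid S\<^esub> x"
  shows "y = y'"
proof -
  note hom = schreier_extensionD[OF S]
  interpret L: monoid "lft S" by (rule hom)
  interpret X: monoid "mid S" by (rule hom)
  have "prj S x \<in> carrier (rgt S)"
    using mon_homD(1)[OF hom(5) x] .
  then obtain u where u: "representative S (prj S x) u"
    using S unfolding schreier_extension_def by blast
  then have uX: "u \<in> carrier (mid S)" and pu: "prj S u = prj S x"
    and uniq: "\<And>z. z \<in> carrier (mid S) \<Longrightarrow> prj S z = prj S x \<Longrightarrow>
      \<exists>!a. a \<in> carrier (lft S) \<and> z = inc S a \<otimes>\<^bsub>mid S\<^esub> u"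
    unfolding representative_def by blast+
  obtain a where a: "a \<in> carrier (lft S)" and xa: "x = inc S a \<otimes>\<^bsub>mid S\<^esub> u"
    using uniq[OF x] by blast
  \<comment> \<open>Uniqueness in front of \<open>u\<close> is available only inside the fibre over
    \<open>prj S x\<close>. Multiplying \<open>u\<close> on the left by \<open>inc S b\<close> stays
    in that fibre because \<open>prj S\<close> sends \<open>inc S b\<close> to the unit.\<close>
  have fib: "inc S b \<otimes>\<^bsub>mid S\<^esub> u \<in> carrier (mid S)"
    "prj S (inc S b \<otimes>\<^bsub>mid S\<^esub> u) = prj S x" if "b \<in> carrier (lft S)" for b
  proof -
    interpret R: monoid "rgt S" by (rule hom)
    have "compose (carrier (lft S)) (prj S) (inc S) = mon_zero (lft S) (rgt S)"
      using S unfolding schreier_extension_def is_kernel_def by blast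
    from compose_eqD[OF this that] have "prj S (inc S b) = \<one>\<^bsub>rgt S\<^esub>"
      using that by (simp add: mon_zero_def)
    then show "inc S b \<otimes>\<^bsub>mid S\<^esub> u \<in> carrier (mid S)"
      "prj S (inc S b \<otimes>\<^bsub>mid S\<^esub> u) = prj S x"
      using mon_homD(1)[OF hom(4) that] mon_homD(1)[OF hom(5) x] uX
      by (simp_all add: mon_homD(2)[OF hom(5)] pu)
  qed
  have "inc S (y \<otimes>\<^bsub>lft S\<^esub> a) \<otimes>\<^bsub>mid S\<^esub> u = inc S (y' \<otimes>\<^bsub>lft S\<^esub> a) \<otimes>\<^bsub>mid S\<^esub> u"
    using eq y a uX by (simp add: xa X.m_assoc mon_homD(1,2)[OF hom(4)])
  then have "y \<otimes>\<^bsub>lft S\<^esub> a = y' \<otimes>\<^bsub>lft S\<^esub> a"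
    using uniq[OF fib[OF L.m_closed[OF y(1) a]]] L.m_closed[OF y(1) a] L.m_closed[OF y(2) a]
    by metis
  then show ?thesis
    using canc y a unfolding right_cancellative_def by blast
qed

text \<open>The definition of \<open>representative\<close> does not mention the carrier of
  \<open>rgt S\<close>. The second fact recovers that \<open>m\<close> lies in it once
  \<open>prj S\<close> is a homomorphism, so that \<open>mon_id\<close> and \<open>compose\<close>
  can be evaluated at \<open>m\<close>.\<close>

lemma representativeD:
  assumes "representative S m u"
  shows "u \<in> carrier (mid S)" "m = prj S u"
  using assms unfolding representative_def by auto

section \<open>Identities and composites of morphisms of Schreier extensions\<close>

lemma schreier_morphism_id:
  assumes "schreier_extension S"
  shows "schreier_morphism S S (mon_id (lft S)) (mon_id (mid S)) (mon_id (rgt S))"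
proof -
  note hom = schreier_extensionD[OF assms]
  have "representative S (mon_id (rgt S) m) (mon_id (mid S) u)" if "representative S m u" for m u
    using that representativeD[OF that] mon_homD(1)[OF hom(5)] by auto
  then show ?thesis
    using hom unfolding schreier_morphism_def
    by (simp add: mon_id_hom compose_mon_id_left compose_mon_id_right)
qed

lemma schreier_morphismD:
  assumes "schreier_morphism S S' p q r"
  shows "p \<in> mon_hom (lft S) (lft S')" "q \<in> mon_hom (mid S) (mid S')" "r \<in> mon_hom (rgt S) (rgt S')"
    and "\<And>a. a \<in> carrier (lft S) \<Longrightarrow> q (inc S a) = inc S' (p a)"
    and "\<And>x. x \<in> carrier (mid S) \<Longrightarrow> r (prj S x) = prj S' (q x)"
    and "\<And>m u. representative S m u \<Longrightarrow> representative S' (r m) (q u)"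
proof -
  have i: "compose (carrier (lft S)) q (inc S) = compose (carrier (lft S)) (inc S') p"
    and p: "compose (carrier (mid S)) r (prj S) = compose (carrier (mid S)) (prj S') q"
    using assms unfolding schreier_morphism_def by blast+
  show "q (inc S a) = inc S' (p a)" if "a \<in> carrier (lft S)" for a
    using compose_eqD[OF i that] that by (simp add: compose_def)
  show "r (prj S x) = prj S' (q x)" if "x \<in> carrier (mid S)" for x
    using compose_eqD[OF p that] that by (simp add: compose_def)
qed (use assms in \<open>unfold schreier_morphism_def, blast+\<close>)

lemma schreier_morphism_comp:
  assumes S: "schreier_extension S"
    and f: "schreier_morphism S S' p q r" and g: "schreier_morphism S' S'' p' q' r'"
  shows "schreier_morphism S S'' (compose (carrier (lft S)) p' p)
    (compose (carrier (mid S)) q' q) (compose (carrier (rgt S)) r' r)"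
proof -
  note hom = schreier_extensionD[OF S]
  note F = schreier_morphismD[OF f] and G = schreier_morphismD[OF g]
  have "representative S'' (compose (carrier (rgt S)) r' r m) (compose (carrier (mid S)) q' q u)"
    if "representative S m u" for m u
    using G(6)[OF F(6)[OF that]] representativeD[OF that] mon_homD(1)[OF hom(5)]
    by (simp add: compose_def)
  moreover have "compose (carrier (lft S)) (compose (carrier (mid S)) q' q) (inc S) =
      compose (carrier (lft S)) (inc S'') (compose (carrier (lft S)) p' p)"
    using F(4) G(4) mon_homD(1)[OF F(1)] mon_homD(1)[OF hom(4)]
    by (intro compose_eqI) (auto simp: compose_def)
  moreover have "compose (carrier (mid S)) (compose (carrier (rgt S)) r' r) (prj S) =
      compose (carrier (mid S)) (prj S'') (compose (carrier (mid S)) q' q)"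
    using F(5) G(5) mon_homD(1)[OF F(2)] mon_homD(1)[OF hom(5)]
    by (intro compose_eqI) (auto simp: compose_def)
  ultimately show ?thesis
    using mon_hom_comp[OF hom(1) F(1) G(1)] mon_hom_comp[OF hom(2) F(2) G(2)]
      mon_hom_comp[OF hom(3) F(3) G(3)]
    unfolding schreier_morphism_def by blast
qed

section \<open>The induced action\<close>

lemma left_seq_simps [simp]:
  "lft (left_seq E) = seqA E" "mid (left_seq E) = seqB E" "rgt (left_seq E) = seqN E"
  "inc (left_seq E) = map\<kappa> E" "prj (left_seq E) = map\<delta> E"
  by (simp_all add: left_seq_def)

lemma right_seq_simps [simp]:
  "lft (right_seq M E) = seqN E" "mid (right_seq M E) = seqC E" "rgt (right_seq M E) = M"
  "inc (right_seq M E) = map\<nu> E" "prj (right_seq M E) = map\<pi> E"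
  by (simp_all add: right_seq_def)

lemma seqN_simps [simp]:
  "carrier (seqN E) = map\<delta> E ` carrier (seqB E)" "mult (seqN E) = mult (seqC E)" "one (seqN E) = one (seqC E)"
  by (simp_all add: seqN_def)

section \<open>A fixed crossed Schreier extension and its basic equations\<close>

locale crossed_schreier =
  fixes M :: "'u monoid" and E :: "'u crossed_seq"
  assumes ext: "crossed_schreier_extension M E"
begin

abbreviation "A \<equiv> seqA E"
abbreviation "B \<equiv> seqB E"
abbreviation "C \<equiv> seqC E"
abbreviation "N \<equiv> seqN E"
abbreviation "\<kappa> \<equiv> map\<kappa> E"
abbreviation "\<delta> \<equiv> map\<delta> E"
abbreviation "\<pi> \<equiv> map\<pi> E"
abbreviation "\<alpha> \<equiv> act\<alpha> E"
abbreviation "\<beta> \<equiv> induced_action M E"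

lemma kernel: "is_kernel A \<kappa> B \<delta> C"
  and cokernel: "is_cokernel B \<delta> C \<pi> M"
  and left: "schreier_extension (left_seq E)"
  and right: "schreier_extension (right_seq M E)"
  and cancel_A: "right_cancellative A"
  and cancel_N: "right_cancellative N"
  using ext unfolding crossed_schreier_extension_def by blast+

sublocale A: monoid A using kernel unfolding is_kernel_def by blast
sublocale B: monoid B using kernel unfolding is_kernel_def by blast
sublocale C: monoid C using kernel unfolding is_kernel_def by blast
sublocale M: monoid M using cokernel unfolding is_cokernel_def by blast

lemma kappa_hom: "\<kappa> \<in> mon_hom A B" and delta_hom: "\<delta> \<in> mon_hom B C" and pi_hom: "\<pi> \<in> mon_hom C M"
  using kernel cokernel unfolding is_kernel_def is_cokernel_def by blast+

lemmas kappa = mon_homD(1-3)[OF kappa_hom]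
lemmas delta = mon_homD(1-3)[OF delta_hom]
lemmas pi = mon_homD(1-3)[OF pi_hom]

lemmas kappa_inj = inj_onD[OF kernel_inj_image(1)[OF kernel]]

lemma delta_kappa: "a \<in> carrier A \<Longrightarrow> \<delta> (\<kappa> a) = \<one>\<^bsub>C\<^esub>"
  using kernel_inj_image(2)[OF kernel] by auto

lemma kappa_exists: "b \<in> carrier B \<Longrightarrow> \<delta> b = \<one>\<^bsub>C\<^esub> \<Longrightarrow> \<exists>a\<in>carrier A. b = \<kappa> a"
  using kernel_inj_image(2)[OF kernel] by blast

lemma pi_surj: "m \<in> carrier M \<Longrightarrow> \<exists>c\<in>carrier C. m = \<pi> c"
  using cokernel_surj[OF cokernel] by blast

lemma alpha_hom: "\<alpha> \<in> mon_hom C (End_monoid B)"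
  and alpha_delta: "b \<in> carrier B \<Longrightarrow> c \<in> carrier C \<Longrightarrow> \<delta> (\<alpha> c b) \<otimes>\<^bsub>C\<^esub> c = c \<otimes>\<^bsub>C\<^esub> \<delta> b"
  and peiffer: "b \<in> carrier B \<Longrightarrow> b' \<in> carrier B \<Longrightarrow> \<alpha> (\<delta> b) b' \<otimes>\<^bsub>B\<^esub> b = b \<otimes>\<^bsub>B\<^esub> b'"
  using ext unfolding crossed_schreier_extension_def crossed_semimodule_def by blast+

lemma alpha_End: "c \<in> carrier C \<Longrightarrow> \<alpha> c \<in> mon_hom B B"
  using mon_homD(1)[OF alpha_hom] by (simp add: End_monoid_def)

lemmas alpha = mon_homD(1-3)[OF alpha_End]

lemma alpha_one: "b \<in> carrier B \<Longrightarrow> \<alpha> \<one>\<^bsub>C\<^esub> b = b"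
  using mon_homD(3)[OF alpha_hom] by (simp add: End_monoid_def)

lemma alpha_mult:
  "c \<in> carrier C \<Longrightarrow> c' \<in> carrier C \<Longrightarrow> b \<in> carrier B \<Longrightarrow> \<alpha> (c \<otimes>\<^bsub>C\<^esub> c') b = \<alpha> c (\<alpha> c' b)"
  using mon_homD(2)[OF alpha_hom] by (simp add: End_monoid_def compose_def)

section \<open>The kernel: centrality, invariance under \<open>C\<close>, and dependence of the
  action on \<pi> only\<close>

lemma kappa_central:
  assumes "a \<in> carrier A" "b \<in> carrier B"
  shows "b \<otimes>\<^bsub>B\<^esub> \<kappa> a = \<kappa> a \<otimes>\<^bsub>B\<^esub> b"
  using peiffer[of "\<kappa> a" b] assms by (simp add: kappa delta_kappa alpha_one)

text \<open>Apply centrality of \<open>\<kappa> y\<close> to the element \<open>\<kappa> x\<close>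
  and pull the equation back along the injective \<kappa>.\<close>

lemma comm_A: "comm_monoid A"
proof (rule A.monoid_comm_monoidI)
  fix x y assume xy: "x \<in> carrier A" "y \<in> carrier A"
  then show "x \<otimes>\<^bsub>A\<^esub> y = y \<otimes>\<^bsub>A\<^esub> x"
    using kappa_central[of y "\<kappa> x"] by (rule_tac kappa_inj) (simp_all add: kappa)
qed

lemma left_cancel_A: "left_cancellative A"
proof -
  interpret cA: comm_monoid A by (rule comm_A)
  show ?thesis
    using cancel_A unfolding left_cancellative_def right_cancellative_def by (metis cA.m_comm)
qed

text \<open>At \<open>\<kappa> a\<close> the first crossed semimodule identity says only that
  \<open>\<delta> (\<alpha> c (\<kappa> a))\<close> times \<open>c\<close> equals \<open>c\<close>,
  and \<open>C\<close> need not be cancellative. But this factor and the unit both lie in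
  \<open>N\<close>, so \<open>schreier_right_cancel\<close> for the sequence from \<open>N\<close>
  to \<open>M\<close> removes \<open>c\<close>.\<close>

lemma alpha_kappa:
  assumes a: "a \<in> carrier A" and c: "c \<in> carrier C"
  shows "\<exists>a'\<in>carrier A. \<alpha> c (\<kappa> a) = \<kappa> a'"
proof (rule kappa_exists)
  show b: "\<alpha> c (\<kappa> a) \<in> carrier B"
    using a c by (simp add: alpha kappa)
  have one: "\<one>\<^bsub>C\<^esub> \<in> carrier N"
    using imageI[OF B.one_closed, of \<delta>] by (simp add: delta)
  show "\<delta> (\<alpha> c (\<kappa> a)) = \<one>\<^bsub>C\<^esub>"
  proof (rule schreier_right_cancel[OF right, of _ _ c])
    show "inc (right_seq M E) (\<delta> (\<alpha> c (\<kappa> a))) \<otimes>\<^bsub>mid (right_seq M E)\<^esub> c =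
        inc (right_seq M E) \<one>\<^bsub>C\<^esub> \<otimes>\<^bsub>mid (right_seq M E)\<^esub> c"
      using alpha_delta[of "\<kappa> a" c] a c b one by (simp add: map\<nu>_def kappa delta_kappa)
  qed (use b c one cancel_N in auto)
qed

text \<open>The Peiffer identity and centrality show that
  \<open>\<alpha> (\<delta> b) (\<kappa> a)\<close> and \<open>\<kappa> a\<close> agree after right
  multiplication by \<open>b\<close>. By \<open>alpha_kappa\<close> both come from \<open>A\<close>,
  so \<open>b\<close> can be cancelled in the sequence from \<open>A\<close> to
  \<open>N\<close>.\<close>

lemma N_acts_trivially:
  assumes a: "a \<in> carrier A" and b: "b \<in> carrier B"
  shows "\<alpha> (\<delta> b) (\<kappa> a) = \<kappa> a"
proof -
  obtain a' where a': "a' \<in> carrier A" "\<alpha> (\<delta> b) (\<kappa> a) = \<kappa> a'"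
    using alpha_kappa[OF a delta(1)[OF b]] by blast
  have "\<kappa> a' \<otimes>\<^bsub>B\<^esub> b = \<kappa> a \<otimes>\<^bsub>B\<^esub> b"
    using peiffer[OF b kappa(1)[OF a]] kappa_central[OF a b] a' by simp
  then have "a' = a"
    using schreier_right_cancel[OF left, of a' a b] a a' b cancel_A by simp
  with a' show ?thesis by simp
qed

text \<open>Every element of the fibre is an element of \<open>N\<close> times one common
  representative \<open>u\<close>. Since \<open>N\<close> acts trivially on the image of \<kappa>,
  all of them act there as \<open>u\<close> does.\<close>

lemma alpha_kappa_cong:
  assumes a: "a \<in> carrier A" and c: "c \<in> carrier C" "c' \<in> carrier C" and eq: "\<pi> c = \<pi> c'"
  shows "\<alpha> c (\<kappa> a) = \<alpha> c' (\<kappa> a)"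
proof -
  obtain u where u: "representative (right_seq M E) (\<pi> c) u"
    using right pi(1)[OF c(1)] unfolding schreier_extension_def by auto
  then have uC: "u \<in> carrier C"
    using representativeD(1) by fastforce
  have "\<alpha> x (\<kappa> a) = \<alpha> u (\<kappa> a)" if x: "x \<in> carrier C" "\<pi> x = \<pi> c" for x
  proof -
    have "\<exists>n. n \<in> carrier N \<and> x = map\<nu> E n \<otimes>\<^bsub>C\<^esub> u"
      using u x unfolding representative_def right_seq_simps by blast
    then obtain b where b: "b \<in> carrier B" "x = \<delta> b \<otimes>\<^bsub>C\<^esub> u"
      by (auto simp: map\<nu>_def)
    \<comment> \<open>\<open>N_acts_trivially\<close> is to be used after \<open>u\<close> has
      acted, so the result of that action must again come from \<open>A\<close>.\<close>
    obtain a' where "a' \<in> carrier A" "\<alpha> u (\<kappa> a) = \<kappa> a'"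
      using alpha_kappa[OF a uC] by blast
    then show ?thesis
      using b a uC N_acts_trivially by (simp add: alpha_mult delta kappa)
  qed
  with c eq show ?thesis by metis
qed

text \<open>Existence of the described element is \<open>alpha_kappa\<close> for one lift plus
  independence of the lift. For uniqueness, \<open>c\<close> itself is a lift, so the condition over
  all lifts is not vacuous, and \<kappa> is injective. Below, \<beta> is handled through these two
  facts; its definition is unfolded only for extensionality.\<close>

lemma induced_action_closed: "c \<in> carrier C \<Longrightarrow> a \<in> carrier A \<Longrightarrow> \<beta> (\<pi> c) a \<in> carrier A"
  and kappa_induced_action: "c \<in> carrier C \<Longrightarrow> a \<in> carrier A \<Longrightarrow> \<kappa> (\<beta> (\<pi> c) a) = \<alpha> c (\<kappa> a)"
proof -
  assume c: "c \<in> carrier C" and a: "a \<in> carrier A"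
  let ?P = "\<lambda>a'. a' \<in> carrier A \<and> (\<forall>d\<in>carrier C. \<pi> d = \<pi> c \<longrightarrow> \<kappa> a' = \<alpha> d (\<kappa> a))"
  obtain a' where a': "a' \<in> carrier A" "\<alpha> c (\<kappa> a) = \<kappa> a'"
    using alpha_kappa[OF a c] by blast
  have "?P a'"
    using a' alpha_kappa_cong[OF a _ c] by metis
  moreover have "x = a'" if "?P x" for x
  proof (rule kappa_inj)
    show "\<kappa> x = \<kappa> a'" using that a'(2) c by metis
  qed (use that a'(1) in blast)+
  ultimately have the: "?P (THE x. ?P x)"
    by (rule theI)
  have "\<beta> (\<pi> c) a = (THE x. ?P x)"
    using a pi(1)[OF c] by (simp add: induced_action_def)
  then have "?P (\<beta> (\<pi> c) a)"
    by (rule ssubst[where P = ?P]) (rule the)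
  then show "\<beta> (\<pi> c) a \<in> carrier A" "\<kappa> (\<beta> (\<pi> c) a) = \<alpha> c (\<kappa> a)"
    using c by blast+
qed

section \<open>The induced action as a homomorphism from \<open>M\<close> to the endomorphisms of
  \<open>A\<close>\<close>

lemma induced_action_End:
  assumes "m \<in> carrier M"
  shows "\<beta> m \<in> mon_hom A A"
proof -
  obtain c where c: "c \<in> carrier C" "m = \<pi> c"
    using pi_surj[OF assms] by blast
  \<comment> \<open>Each law for \<open>\<beta> (\<pi> c)\<close> is checked after applying the
    injective \<kappa>, where it becomes the same law for the endomorphism
    \<open>\<alpha> c\<close>.\<close>
  note k = kappa_induced_action[OF c(1)] and cl = induced_action_closed[OF c(1)]
  show ?thesis
    unfolding c(2)
  proof (rule mon_homI)
    fix x y assume "x \<in> carrier A" "y \<in> carrier A"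
    then show "\<beta> (\<pi> c) (x \<otimes>\<^bsub>A\<^esub> y) = \<beta> (\<pi> c) x \<otimes>\<^bsub>A\<^esub> \<beta> (\<pi> c) y"
      using c(1) by (rule_tac kappa_inj) (simp_all add: k cl kappa alpha)
  next
    show "\<beta> (\<pi> c) \<one>\<^bsub>A\<^esub> = \<one>\<^bsub>A\<^esub>"
      using c(1) by (rule_tac kappa_inj) (simp_all add: k cl kappa alpha)
  next
    show "\<beta> (\<pi> c) \<in> extensional (carrier A)"
      using pi(1)[OF c(1)] by (simp add: induced_action_def)
  qed (rule cl)
qed

lemma induced_action_hom: "\<beta> \<in> mon_hom M (End_monoid A)"
proof (rule mon_homI)
  fix m m' assume m: "m \<in> carrier M" "m' \<in> carrier M"
  obtain c c' where c: "c \<in> carrier C" "m = \<pi> c" "c' \<in> carrier C" "m' = \<pi> c'"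
    using pi_surj[OF m(1)] pi_surj[OF m(2)] by blast
  have mm: "m \<otimes>\<^bsub>M\<^esub> m' = \<pi> (c \<otimes>\<^bsub>C\<^esub> c')"
    using c by (simp add: pi)
  have "\<beta> (m \<otimes>\<^bsub>M\<^esub> m') = compose (carrier A) (\<beta> m) (\<beta> m')"
  proof (rule mon_homs_eqI[OF induced_action_End])
    show "compose (carrier A) (\<beta> m) (\<beta> m') \<in> mon_hom A A"
      by (rule mon_hom_comp[OF A.monoid_axioms induced_action_End[OF m(2)] induced_action_End[OF m(1)]])
    fix a assume a: "a \<in> carrier A"
    show "\<beta> (m \<otimes>\<^bsub>M\<^esub> m') a = compose (carrier A) (\<beta> m) (\<beta> m') a"
      using a c unfolding mm unfolding c(2,4)
      by (rule_tac kappa_inj)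
        (simp_all add: compose_def kappa_induced_action induced_action_closed alpha_mult kappa)
  qed (use m in simp)
  then show "\<beta> (m \<otimes>\<^bsub>M\<^esub> m') = \<beta> m \<otimes>\<^bsub>End_monoid A\<^esub> \<beta> m'"
    by (simp add: End_monoid_def)
next
  have "\<beta> \<one>\<^bsub>M\<^esub> = mon_id A"
  proof (rule mon_homs_eqI[OF induced_action_End mon_id_hom])
    fix a assume a: "a \<in> carrier A"
    show "\<beta> \<one>\<^bsub>M\<^esub> a = mon_id A a"
      \<comment> \<open>The unit of \<open>M\<close> is lifted to the unit of \<open>C\<close>,
        which acts as the identity.\<close>
      using a unfolding pi(3)[symmetric]
      by (rule_tac kappa_inj) (simp_all add: kappa_induced_action induced_action_closed alpha_one kappa)
  qed (simp_all add: A.monoid_axioms)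
  then show "\<beta> \<one>\<^bsub>M\<^esub> = \<one>\<^bsub>End_monoid A\<^esub>"
    by (simp add: End_monoid_def)
next
  show "\<beta> \<in> extensional (carrier M)"
    by (simp add: induced_action_def)
qed (simp add: End_monoid_def induced_action_End)

lemma D1_obj_closed: "D1_obj M E \<in> Ob (canSmod M)"
  by (simp add: D1_obj_def canSmod_def comm_A left_cancel_A cancel_A induced_action_hom)

end

section \<open>Categories and the functor\<close>

text \<open>This evaluates the definite description \<open>induced_A\<close>: since
  \<open>map\<kappa> E'\<close> is injective, the commuting square determines the map
  pointwise.\<close>

lemma induced_A_eqI:
  fixes E E' :: "'u crossed_seq"
  assumes E': "crossed_schreier_extension M E'" and h: "h \<in> mon_hom (seqA E) (seqA E')"
    and eq: "\<And>a. a \<in> carrier (seqA E) \<Longrightarrow> map\<kappa> E' (h a) = \<phi> (map\<kappa> E a)"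
  shows "induced_A E E' \<phi> = h"
  unfolding induced_A_def
proof (rule the_equality)
  show "h \<in> mon_hom (seqA E) (seqA E') \<and>
    compose (carrier (seqA E)) (map\<kappa> E') h = compose (carrier (seqA E)) \<phi> (map\<kappa> E)"
    using h eq by (auto intro!: compose_eqI simp: compose_def)
next
  interpret E': crossed_schreier M E' by (unfold_locales) (rule E')
  fix g assume g: "g \<in> mon_hom (seqA E) (seqA E') \<and>
    compose (carrier (seqA E)) (map\<kappa> E') g = compose (carrier (seqA E)) \<phi> (map\<kappa> E)"
  then have gh: "g \<in> mon_hom (seqA E) (seqA E')"
    and kg: "compose (carrier (seqA E)) (map\<kappa> E') g = compose (carrier (seqA E)) \<phi> (map\<kappa> E)"
    by blast+
  show "g = h"
  proof (rule mon_homs_eqI[OF gh h])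
    fix a assume a: "a \<in> carrier (seqA E)"
    then have "map\<kappa> E' (g a) = \<phi> (map\<kappa> E a)"
      using compose_eqD[OF kg] by (simp add: compose_def)
    then show "g a = h a"
      using mon_homD(1)[OF gh a] mon_homD(1)[OF h a] by (rule_tac E'.kappa_inj) (simp_all add: eq a)
  qed
qed

text \<open>As \<open>map\<nu>\<close> is the inclusion of the image, the defining square says just
  that the induced map is \<psi> restricted to \<open>N\<close>.\<close>

lemma induced_N_eqI:
  assumes h: "h \<in> mon_hom (seqN E) (seqN E')"
    and eq: "\<And>n. n \<in> carrier (seqN E) \<Longrightarrow> h n = \<psi> n"
  shows "induced_N E E' \<psi> = h"
  unfolding induced_N_def
proof (rule the_equality)
  show "h \<in> mon_hom (seqN E) (seqN E') \<and>
    compose (carrier (seqN E)) (map\<nu> E') h = compose (carrier (seqN E)) \<psi> (map\<nu> E)"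
    using h eq mon_homD(1)[OF h]
    by (auto intro!: compose_eqI simp: compose_def map\<nu>_def simp del: seqN_simps)
next
  fix g assume g: "g \<in> mon_hom (seqN E) (seqN E') \<and>
    compose (carrier (seqN E)) (map\<nu> E') g = compose (carrier (seqN E)) \<psi> (map\<nu> E)"
  then have gh: "g \<in> mon_hom (seqN E) (seqN E')"
    and ng: "compose (carrier (seqN E)) (map\<nu> E') g = compose (carrier (seqN E)) \<psi> (map\<nu> E)"
    by blast+
  show "g = h"
  proof (rule mon_homs_eqI[OF gh h])
    fix n assume n: "n \<in> carrier (seqN E)"
    then have "map\<nu> E' (g n) = \<psi> n"
      using compose_eqD[OF ng]
      by (simp add: compose_def map\<nu>_def del: seqN_simps)
    then show "g n = h n"
      using n eq mon_homD(1)[OF gh n] by (simp add: map\<nu>_def del: seqN_simps)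
  qed
qed

text \<open>The facts on \<open>induced_A\<close> and \<open>induced_N\<close> are read off the two
  Schreier morphisms that a morphism carries: these already assert that the induced maps are
  homomorphisms and that their squares commute.\<close>

lemma XSExt_homD:
  assumes "(\<phi>, \<psi>) \<in> XSExt_hom M E E'"
  shows "\<phi> \<in> mon_hom (seqB E) (seqB E')" "\<psi> \<in> mon_hom (seqC E) (seqC E')"
    and "\<And>b. b \<in> carrier (seqB E) \<Longrightarrow> map\<delta> E' (\<phi> b) = \<psi> (map\<delta> E b)"
    and "\<And>c b. c \<in> carrier (seqC E) \<Longrightarrow> b \<in> carrier (seqB E) \<Longrightarrow>
      \<phi> (act\<alpha> E c b) = act\<alpha> E' (\<psi> c) (\<phi> b)"
    and "\<And>c. c \<in> carrier (seqC E) \<Longrightarrow> map\<pi> E' (\<psi> c) = map\<pi> E c"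
    and "schreier_morphism (left_seq E) (left_seq E') (induced_A E E' \<phi>) \<phi> (induced_N E E' \<psi>)"
    and "schreier_morphism (right_seq M E) (right_seq M E') (induced_N E E' \<psi>) \<psi> (mon_id M)"
    and "induced_A E E' \<phi> \<in> mon_hom (seqA E) (seqA E')"
    and "induced_N E E' \<psi> \<in> mon_hom (seqN E) (seqN E')"
    and "\<And>a. a \<in> carrier (seqA E) \<Longrightarrow> map\<kappa> E' (induced_A E E' \<phi> a) = \<phi> (map\<kappa> E a)"
    and "\<And>n. n \<in> carrier (seqN E) \<Longrightarrow> induced_N E E' \<psi> n = \<psi> n"
proof -
  have cs: "crossed_semimodule_morphism E E' \<phi> \<psi>"
    and p: "compose (carrier (seqC E)) (map\<pi> E') \<psi> = map\<pi> E"
    and l: "schreier_morphism (left_seq E) (left_seq E') (induced_A E E' \<phi>) \<phi> (induced_N E E' \<psi>)"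
    and r: "schreier_morphism (right_seq M E) (right_seq M E') (induced_N E E' \<psi>) \<psi> (mon_id M)"
    using assms unfolding XSExt_hom_def by auto
  show "\<phi> \<in> mon_hom (seqB E) (seqB E')" "\<psi> \<in> mon_hom (seqC E) (seqC E')"
    and "\<And>c b. c \<in> carrier (seqC E) \<Longrightarrow> b \<in> carrier (seqB E) \<Longrightarrow>
      \<phi> (act\<alpha> E c b) = act\<alpha> E' (\<psi> c) (\<phi> b)"
    using cs unfolding crossed_semimodule_morphism_def by blast+
  have d: "compose (carrier (seqB E)) (map\<delta> E') \<phi> = compose (carrier (seqB E)) \<psi> (map\<delta> E)"
    using cs unfolding crossed_semimodule_morphism_def by blast
  show "map\<delta> E' (\<phi> b) = \<psi> (map\<delta> E b)" if "b \<in> carrier (seqB E)" for b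
    using compose_eqD[OF d that] that by (simp add: compose_def)
  show "map\<pi> E' (\<psi> c) = map\<pi> E c" if "c \<in> carrier (seqC E)" for c
    using compose_eqD[OF p that] .
  show "schreier_morphism (left_seq E) (left_seq E') (induced_A E E' \<phi>) \<phi> (induced_N E E' \<psi>)"
    and "schreier_morphism (right_seq M E) (right_seq M E') (induced_N E E' \<psi>) \<psi> (mon_id M)"
    by (rule l r)+
  show "induced_A E E' \<phi> \<in> mon_hom (seqA E) (seqA E')"
    and hN: "induced_N E E' \<psi> \<in> mon_hom (seqN E) (seqN E')"
    using l unfolding schreier_morphism_def by simp_all
  show "map\<kappa> E' (induced_A E E' \<phi> a) = \<phi> (map\<kappa> E a)" if "a \<in> carrier (seqA E)" for a
    using schreier_morphismD(4)[OF l] that by simp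
  show "induced_N E E' \<psi> n = \<psi> n" if "n \<in> carrier (seqN E)" for n
    using schreier_morphismD(4)[OF r, of n] mon_homD(1)[OF hN that] that
    by (simp add: map\<nu>_def del: seqN_simps)
qed

text \<open>The induced maps occur in the definition of \<open>XSExt_hom\<close>, so they are
  computed before membership is shown. The second conclusion is the preservation of identities by
  the functor.\<close>

lemma XSExt_id_closed:
  assumes "crossed_schreier_extension M E"
  shows "(mon_id (seqB E), mon_id (seqC E)) \<in> XSExt_hom M E E"
    and "induced_A E E (mon_id (seqB E)) = mon_id (seqA E)"
proof -
  interpret crossed_schreier M E by unfold_locales (rule assms)
  have N: "monoid N" using schreier_extensionD(3)[OF left] by simp
  have NC: "n \<in> carrier C" if "n \<in> carrier N" for n using that delta(1) by auto
  show iA: "induced_A E E (mon_id B) = mon_id A"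
    by (rule induced_A_eqI[OF assms]) (simp_all add: mon_id_hom A.monoid_axioms kappa)
  have iN: "induced_N E E (mon_id C) = mon_id N"
    by (rule induced_N_eqI) (simp_all add: mon_id_hom N NC del: seqN_simps)
  have "crossed_semimodule_morphism E E (mon_id B) (mon_id C)"
    unfolding crossed_semimodule_morphism_def
    by (simp add: mon_id_hom B.monoid_axioms C.monoid_axioms alpha
        compose_mon_id_left[OF delta_hom] compose_mon_id_right[OF delta_hom])
  moreover have "compose (carrier C) \<pi> (mon_id C) = \<pi>"
    by (rule compose_mon_id_right[OF pi_hom])
  ultimately show "(mon_id B, mon_id C) \<in> XSExt_hom M E E"
    using schreier_morphism_id[OF left] schreier_morphism_id[OF right]
    unfolding XSExt_hom_def by (simp add: iA iN)
qed

text \<open>As for identities, the induced maps are computed first: they compose along with the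
  given maps. The second conclusion is the preservation of composition by the functor.\<close>

lemma XSExt_comp_closed:
  assumes E: "crossed_schreier_extension M E" and E'': "crossed_schreier_extension M E''"
    and f: "(\<phi>, \<psi>) \<in> XSExt_hom M E E'" and g: "(\<phi>', \<psi>') \<in> XSExt_hom M E' E''"
  shows "(compose (carrier (seqB E)) \<phi>' \<phi>, compose (carrier (seqC E)) \<psi>' \<psi>) \<in> XSExt_hom M E E''"
    and "induced_A E E'' (compose (carrier (seqB E)) \<phi>' \<phi>) =
      compose (carrier (seqA E)) (induced_A E' E'' \<phi>') (induced_A E E' \<phi>)"
proof -
  interpret crossed_schreier M E by unfold_locales (rule E)
  note F = XSExt_homD[OF f] and G = XSExt_homD[OF g]
  have N: "monoid N" using schreier_extensionD(3)[OF left] by simp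
  have NC: "n \<in> carrier C" if "n \<in> carrier N" for n using that delta(1) by auto
  show iA: "induced_A E E'' (compose (carrier B) \<phi>' \<phi>) =
      compose (carrier A) (induced_A E' E'' \<phi>') (induced_A E E' \<phi>)"
    by (rule induced_A_eqI[OF E'' mon_hom_comp[OF A.monoid_axioms F(8) G(8)]])
      (simp add: compose_def kappa F(10) G(10) mon_homD(1)[OF F(8)])
  have iN: "induced_N E E'' (compose (carrier C) \<psi>' \<psi>) =
      compose (carrier N) (induced_N E' E'' \<psi>') (induced_N E E' \<psi>)"
  proof (rule induced_N_eqI)
    fix n assume n: "n \<in> carrier N"
    show "compose (carrier N) (induced_N E' E'' \<psi>') (induced_N E E' \<psi>) n =
        compose (carrier C) \<psi>' \<psi> n"
      using F(11)[OF n] G(11)[OF mon_homD(1)[OF F(9) n]] n NC[OF n]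
      by (simp add: compose_def del: seqN_simps)
  qed (rule mon_hom_comp[OF N F(9) G(9)])
  have "crossed_semimodule_morphism E E'' (compose (carrier B) \<phi>' \<phi>) (compose (carrier C) \<psi>' \<psi>)"
    unfolding crossed_semimodule_morphism_def
  proof (intro conjI ballI)
    show "compose (carrier B) (map\<delta> E'') (compose (carrier B) \<phi>' \<phi>) =
        compose (carrier B) (compose (carrier C) \<psi>' \<psi>) \<delta>"
      by (rule compose_eqI) (simp_all add: compose_def delta F(3) G(3) mon_homD(1)[OF F(1)])
  next
    fix c b assume "c \<in> carrier C" "b \<in> carrier B"
    then show "compose (carrier B) \<phi>' \<phi> (\<alpha> c b) =
        act\<alpha> E'' (compose (carrier C) \<psi>' \<psi> c) (compose (carrier B) \<phi>' \<phi> b)"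
      by (simp add: compose_def alpha F(4) G(4) mon_homD(1)[OF F(1)] mon_homD(1)[OF F(2)])
  qed (rule mon_hom_comp[OF B.monoid_axioms F(1) G(1)] mon_hom_comp[OF C.monoid_axioms F(2) G(2)])+
  moreover have "compose (carrier C) (map\<pi> E'') (compose (carrier C) \<psi>' \<psi>) = \<pi>"
    by (rule compose_eqI)
      (simp_all add: compose_def F(5) G(5) mon_homD(1)[OF F(2)] mon_homD(4)[OF pi_hom])
  moreover have "schreier_morphism (left_seq E) (left_seq E'')
      (induced_A E E'' (compose (carrier B) \<phi>' \<phi>)) (compose (carrier B) \<phi>' \<phi>)
      (induced_N E E'' (compose (carrier C) \<psi>' \<psi>))"
    using schreier_morphism_comp[OF left F(6) G(6)] unfolding iA iN left_seq_simps .
  moreover have "schreier_morphism (right_seq M E) (right_seq M E'')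
      (induced_N E E'' (compose (carrier C) \<psi>' \<psi>)) (compose (carrier C) \<psi>' \<psi>) (mon_id M)"
    using schreier_morphism_comp[OF right F(7) G(7)]
    unfolding iN right_seq_simps compose_mon_id_left[OF mon_id_hom[OF M.monoid_axioms]] .
  ultimately show "(compose (carrier B) \<phi>' \<phi>, compose (carrier C) \<psi>' \<psi>) \<in> XSExt_hom M E E''"
    unfolding XSExt_hom_def by blast
qed

section \<open>The category axioms; extensionality turns the unit laws into equalities of
  functions\<close>

lemma category_XSExt: "category (XSExt M)"
proof unfold_locales
  fix E assume "E \<in> Ob (XSExt M)"
  then show "Ident (XSExt M) E \<in> Hom (XSExt M) E E"
    by (simp add: XSExt_def XSExt_id_closed)
next
  fix E E' E'' f g
  assume "E \<in> Ob (XSExt M)" "E'' \<in> Ob (XSExt M)"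
    "f \<in> Hom (XSExt M) E E'" "g \<in> Hom (XSExt M) E' E''"
  then show "Comp (XSExt M) E E' E'' g f \<in> Hom (XSExt M) E E''"
    by (cases f; cases g) (simp add: XSExt_def XSExt_comp_closed(1))
next
  fix E E' f assume "f \<in> Hom (XSExt M) E E'"
  then show "Comp (XSExt M) E E' E' (Ident (XSExt M) E') f = f"
    by (cases f) (auto simp: XSExt_def compose_mon_id_left dest: XSExt_homD(1,2))
next
  fix E E' f assume "f \<in> Hom (XSExt M) E E'"
  then show "Comp (XSExt M) E E E' f (Ident (XSExt M) E) = f"
    by (cases f) (auto simp: XSExt_def compose_mon_id_right dest: XSExt_homD(1,2))
next
  fix D E E' E'' f g h assume "f \<in> Hom (XSExt M) D E"
  then show "Comp (XSExt M) D E' E'' h (Comp (XSExt M) D E E' g f) =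
      Comp (XSExt M) D E E'' (Comp (XSExt M) E E' E'' h g) f"
    by (cases f; cases g; cases h)
      (simp add: XSExt_def compose_mon_hom_assoc[OF XSExt_homD(1)] compose_mon_hom_assoc[OF XSExt_homD(2)])
qed

lemma category_canSmod: "category (canSmod M)"
proof unfold_locales
  fix X assume X: "X \<in> Ob (canSmod M)"
  obtain A \<beta> where X_eq: "X = (A, \<beta>)" by fastforce
  have A: "monoid A" and \<beta>: "\<beta> \<in> mon_hom M (End_monoid A)"
    using X by (auto simp: X_eq canSmod_def comm_monoid.axioms(1))
  \<comment> \<open>\<open>mon_id A\<close> is the identity only on the carrier, and equivariance
    evaluates it at \<open>\<beta> m a\<close>.\<close>
  have "\<beta> m a \<in> carrier A" if "m \<in> carrier M" "a \<in> carrier A" for m a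
    using mon_homD(1)[OF \<beta> that(1)] mon_homD(1)[of "\<beta> m" A A, OF _ that(2)]
    by (simp add: End_monoid_def)
  then show "Ident (canSmod M) X \<in> Hom (canSmod M) X X"
    by (simp add: X_eq canSmod_def mon_id_hom[OF A])
next
  fix X Y Z f g
  assume X: "X \<in> Ob (canSmod M)" and f: "f \<in> Hom (canSmod M) X Y" and g: "g \<in> Hom (canSmod M) Y Z"
  obtain A \<beta> A' \<beta>' A'' \<beta>'' where eqs: "X = (A, \<beta>)" "Y = (A', \<beta>')" "Z = (A'', \<beta>'')"
    by (metis surj_pair)
  have A: "monoid A" and \<beta>: "\<beta> \<in> mon_hom M (End_monoid A)"
    using X by (auto simp: eqs canSmod_def comm_monoid.axioms(1))
  have cl: "\<beta> m a \<in> carrier A" if "m \<in> carrier M" "a \<in> carrier A" for m a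
    using mon_homD(1)[OF \<beta> that(1)] mon_homD(1)[of "\<beta> m" A A, OF _ that(2)]
    by (simp add: End_monoid_def)
  have fh: "f \<in> mon_hom A A'" and gh: "g \<in> mon_hom A' A''"
    using f g by (auto simp: eqs canSmod_def)
  show "Comp (canSmod M) X Y Z g f \<in> Hom (canSmod M) X Z"
    using mon_hom_comp[OF A fh gh] f g mon_homD(1)[OF fh] cl
    by (simp add: eqs canSmod_def compose_def)
next
  fix X Y f assume "f \<in> Hom (canSmod M) X Y"
  then show "Comp (canSmod M) X Y Y (Ident (canSmod M) Y) f = f"
    by (cases X; cases Y) (simp add: canSmod_def compose_mon_id_left)
next
  fix X Y f assume "f \<in> Hom (canSmod M) X Y"
  then show "Comp (canSmod M) X X Y f (Ident (canSmod M) X) = f"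
    by (cases X; cases Y) (auto simp: canSmod_def intro: compose_mon_id_right)
next
  fix W X Y Z f g h assume "f \<in> Hom (canSmod M) W X"
  then show "Comp (canSmod M) W Y Z h (Comp (canSmod M) W X Y g f) =
      Comp (canSmod M) W X Z (Comp (canSmod M) X Y Z h g) f"
    by (cases W; cases X) (simp add: canSmod_def compose_mon_hom_assoc)
qed

text \<open>If \<open>c\<close> lifts \<open>m\<close>, then so does \<open>\<psi> c\<close>,
  because \<psi> is compatible with the projections to \<open>M\<close>. Computing both actions with
  these lifts, the images under \<open>map\<kappa> E'\<close> agree by the equivariance of \<phi>
  along \<psi>, and \<open>map\<kappa> E'\<close> is injective.\<close>

lemma induced_A_equivariant:
  assumes E: "crossed_schreier_extension M E" and E': "crossed_schreier_extension M E'"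
    and f: "(\<phi>, \<psi>) \<in> XSExt_hom M E E'" and m: "m \<in> carrier M" and a: "a \<in> carrier (seqA E)"
  shows "induced_A E E' \<phi> (induced_action M E m a) =
    induced_action M E' m (induced_A E E' \<phi> a)"
proof -
  interpret E: crossed_schreier M E by unfold_locales (rule E)
  interpret E': crossed_schreier M E' by unfold_locales (rule E')
  note F = XSExt_homD[OF f]
  obtain c where c: "c \<in> carrier (seqC E)" "m = map\<pi> E c"
    using E.pi_surj[OF m] by blast
  then have c': "\<psi> c \<in> carrier (seqC E')" "m = map\<pi> E' (\<psi> c)"
    using mon_homD(1)[OF F(2)] F(5) by auto
  note hA = mon_homD(1)[OF F(8)]
  have cl: "induced_action M E m a \<in> carrier (seqA E)"
    using E.induced_action_closed c a by simp
  have "map\<kappa> E' (induced_A E E' \<phi> (induced_action M E m a)) =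
      map\<kappa> E' (induced_action M E' m (induced_A E E' \<phi> a))"
    using E.kappa_induced_action[OF c(1) a] E'.kappa_induced_action[OF c'(1) hA[OF a]]
    by (simp add: F(10) cl a F(4)[OF c(1)] E.kappa flip: c(2) c'(2))
  then show ?thesis
    using hA[OF cl] E'.induced_action_closed[OF c'(1) hA[OF a]]
    by (rule_tac E'.kappa_inj) (simp_all flip: c'(2))
qed

text \<open>The last two conjuncts tie the functor to its intended values: they give the equations
  that the definite descriptions behind \<open>D1_obj\<close> and \<open>D1_mor\<close> are meant to
  satisfy.\<close>

theorem proposition4p8:
  fixes M :: "'u monoid"
  assumes "monoid M"
  shows "category_functor (XSExt M) (canSmod M) (D1_obj M) D1_mor \<and>
    (\<forall>E\<in>Ob (XSExt M). \<forall>c\<in>carrier (seqC E). \<forall>a\<in>carrier (seqA E).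
       map\<kappa> E (snd (D1_obj M E) (map\<pi> E c) a) = act\<alpha> E c (map\<kappa> E a)) \<and>
    (\<forall>E\<in>Ob (XSExt M). \<forall>E'\<in>Ob (XSExt M). \<forall>(\<phi>, \<psi>)\<in>Hom (XSExt M) E E'. \<forall>a\<in>carrier (seqA E).
       map\<kappa> E' (D1_mor E E' (\<phi>, \<psi>) a) = \<phi> (map\<kappa> E a))"
proof (intro conjI)
  interpret S: category "XSExt M" by (rule category_XSExt)
  interpret T: category "canSmod M" by (rule category_canSmod)
  show "category_functor (XSExt M) (canSmod M) (D1_obj M) D1_mor"
  proof unfold_locales
    fix E assume "E \<in> Ob (XSExt M)"
    then interpret crossed_schreier M E by unfold_locales (simp add: XSExt_def)
    show "D1_obj M E \<in> Ob (canSmod M)"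
      by (rule D1_obj_closed)
  next
    fix E E' f
    assume "E \<in> Ob (XSExt M)" "E' \<in> Ob (XSExt M)" "f \<in> Hom (XSExt M) E E'"
    then show "D1_mor E E' f \<in> Hom (canSmod M) (D1_obj M E) (D1_obj M E')"
      by (cases f)
        (simp add: XSExt_def canSmod_def D1_obj_def D1_mor_def XSExt_homD(8) induced_A_equivariant)
  next
    fix E assume "E \<in> Ob (XSExt M)"
    then show "D1_mor E E (Ident (XSExt M) E) = Ident (canSmod M) (D1_obj M E)"
      by (simp add: XSExt_def canSmod_def D1_obj_def D1_mor_def XSExt_id_closed(2))
  next
    fix E E' E'' f g
    assume "E \<in> Ob (XSExt M)" "E'' \<in> Ob (XSExt M)"
      "f \<in> Hom (XSExt M) E E'" "g \<in> Hom (XSExt M) E' E''"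
    then show "D1_mor E E'' (Comp (XSExt M) E E' E'' g f) =
        Comp (canSmod M) (D1_obj M E) (D1_obj M E') (D1_obj M E'') (D1_mor E' E'' g) (D1_mor E E' f)"
      by (cases f; cases g)
        (simp add: XSExt_def canSmod_def D1_obj_def D1_mor_def XSExt_comp_closed(2))
  qed
next
  show "\<forall>E\<in>Ob (XSExt M). \<forall>c\<in>carrier (seqC E). \<forall>a\<in>carrier (seqA E).
      map\<kappa> E (snd (D1_obj M E) (map\<pi> E c) a) = act\<alpha> E c (map\<kappa> E a)"
    by (simp add: XSExt_def D1_obj_def crossed_schreier.kappa_induced_action crossed_schreier.intro)
next
  show "\<forall>E\<in>Ob (XSExt M). \<forall>E'\<in>Ob (XSExt M). \<forall>(\<phi>, \<psi>)\<in>Hom (XSExt M) E E'. \<forall>a\<in>carrier (seqA E).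
      map\<kappa> E' (D1_mor E E' (\<phi>, \<psi>) a) = \<phi> (map\<kappa> E a)"
    by (auto simp: XSExt_def D1_mor_def XSExt_homD(10))
qed

end
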